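(* Let $i\in\{1,2\}$ and $m,n\in\mathbb N$ with $n>m\ge 5$ and $m-1\nmid (n-3)$. Then $m+n-5\le r(T_m^i,T_n')\le m+n-4$ and $m+n-6\le r(T_m^i,T_n^* )\le m+n-4$. Moreover, write $n=k(m-1)+b=q(m-2)+a$ with $k,q\in\mathbb N$, $a\in\{0,1,\ldots,m-3\}$ and $b\in\{0,1,\ldots,m-2\}$. If at least one of the following holds: (1) $b\in\{1,2,4\}$; (2) $b=0$ and $k\ge 3$; (3) $n\ge (m-3)^2+2$; (4) $n\ge m^2-1-b(m-2)$; (5) $a\ge 3$ and $n\ge (a-4)(m-1)+4$, then $r(T_m^i,T_n^* )=r(T_m^i,T_n')=m+n-4$.
   Context: All graphs are finite and simple; a graph "contains" $H$ if it has a subgraph isomorphic to $H$. For graphs $G_1,G_2$, the Ramsey number $r(G_1,G_2)$ is the smallest positive integer $N$ such that for every graph $G$ on $N$ vertices, either $G$ contains a copy of $G_1$ or the complement $\overline G$ contains a copy of $G_2$. For $m\ge 5$, $T_m^1$ is the tree with vertex set $\{v_0,\ldots,v_{m-1}\}$ and edges $v_0v_1,\ldots,v_0v_{m-3},v_{m-4}v_{m-2},v_{m-3}v_{m-1}$, and $T_m^2$ is the tree on the same vertex set with edges $v_0v_1,\ldots,v_0v_{m-3},v_{m-3}v_{m-2},v_{m-3}v_{m-1}$. For $n\ge 4$, $T_n'$ is the unique (up to isomorphism) tree on $n$ vertices with maximum degree $n-2$, and $T_n^*$ is the tree on $\{v_0,\ldots,v_{n-1}\}$ with edges $v_0v_1,\ldots,v_0v_{n-3},v_{n-3}v_{n-2},v_{n-2}v_{n-1}$.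 *)

theory Defs
  imports Main
begin

text \<open>A (simple) graph on the vertex set {0..<N} is given by a symmetric, irreflexive
adjacency relation; values outside {0..<N} are irrelevant.\<close>

definition simple_graph_on :: "nat \<Rightarrow> (nat \<Rightarrow> nat \<Rightarrow> bool) \<Rightarrow> bool" where
  "simple_graph_on N G \<longleftrightarrow>
     (\<forall>u<N. \<forall>v<N. G u v \<longleftrightarrow> G v u) \<and> (\<forall>u<N. \<not> G u u)"

definition complement :: "(nat \<Rightarrow> nat \<Rightarrow> bool) \<Rightarrow> nat \<Rightarrow> nat \<Rightarrow> bool" where
  "complement G u v \<longleftrightarrow> u \<noteq> v \<and> \<not> G u v"

text \<open>A pattern graph H with vertex set {0..<h} and edge set E (unordered edges listed as pairs).
The host graph G on {0..<N} contains H iff there is an injective map of the vertices of H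
into {0..<N} sending edges to edges.\<close>

definition contains :: "nat \<Rightarrow> (nat \<times> nat) set \<Rightarrow> nat \<Rightarrow> (nat \<Rightarrow> nat \<Rightarrow> bool) \<Rightarrow> bool" where
  "contains h E N G \<longleftrightarrow>
     (\<exists>f. inj_on f {..<h} \<and> f ` {..<h} \<subseteq> {..<N} \<and> (\<forall>(u,v)\<in>E. G (f u) (f v)))"

definition ramsey_number :: "nat \<Rightarrow> (nat \<times> nat) set \<Rightarrow> nat \<Rightarrow> (nat \<times> nat) set \<Rightarrow> nat" where
  "ramsey_number h1 E1 h2 E2 =
     (LEAST N. 0 < N \<and> (\<forall>G. simple_graph_on N G \<longrightarrow>
         contains h1 E1 N G \<or> contains h2 E2 N (complement G)))"

definition star_edges :: "nat \<Rightarrow> (nat \<times> nat) set" where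
  "star_edges k = {(0, j) | j. 1 \<le> j \<and> j \<le> k}"

definition T1_edges :: "nat \<Rightarrow> (nat \<times> nat) set" where
  "T1_edges m = star_edges (m - 3) \<union> {(m - 4, m - 2), (m - 3, m - 1)}"

definition T2_edges :: "nat \<Rightarrow> (nat \<times> nat) set" where
  "T2_edges m = star_edges (m - 3) \<union> {(m - 3, m - 2), (m - 3, m - 1)}"

definition Tprime_edges :: "nat \<Rightarrow> (nat \<times> nat) set" where
  "Tprime_edges n = star_edges (n - 2) \<union> {(n - 2, n - 1)}"

definition Tstar_edges :: "nat \<Rightarrow> (nat \<times> nat) set" where
  "Tstar_edges n = star_edges (n - 3) \<union> {(n - 3, n - 2), (n - 2, n - 1)}"

definition Tmi_edges :: "nat \<Rightarrow> nat \<Rightarrow> (nat \<times> nat) set" where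
  "Tmi_edges i m = (if i = 1 then T1_edges m else T2_edges m)"

end

theory Submission
  imports Defs
begin

text \<open>Upper bound: a graph without \<open>T\<^sub>m\<^sup>i\<close> in which all degrees are at least \<open>m - 2\<close> is a disjoint
  union of copies of \<open>K\<^bsub>m-1\<^esub>\<close>. Since \<open>m - 1\<close> does not divide \<open>m + n - 4 = (m - 1) + (n - 3)\<close>, a
  \<open>T\<^sub>m\<^sup>i\<close>-free graph on \<open>m + n - 4\<close> vertices has a vertex \<open>v\<close> of degree at most \<open>m - 3\<close>. The star of
  \<open>v\<close> in the complement extends to both \<open>T\<^sub>n'\<close> and \<open>T\<^sub>n\<^sup>*\<close>, because otherwise the graph is so dense
  among or towards the non-neighbours of \<open>v\<close> that it contains \<open>T\<^sub>m\<^sup>i\<close>.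

  Lower bounds: an \<open>(m-4)\<close>-regular graph, with one component \<open>K\<^bsub>m-2\<^esub>\<close> if parity requires it, has no
  \<open>T\<^sub>m\<^sup>i\<close>, and the degrees of its complement are too small. Each of the conditions (1)--(5) makes
  \<open>m + n - 5\<close> a sum of copies of \<open>m - 1\<close> and \<open>m - 2\<close>; then the disjoint union of cliques of these sizes
  shows that \<open>m + n - 4\<close> is sharp.\<close>

text \<open>Vertices are natural numbers, and linear arithmetic would split every disequation between
  two of them.\<close>

declare [[linarith_neq_limit = 1]]

section \<open>Neighbourhoods inside a vertex set and small cardinality facts\<close>

definition nbrs_in :: "nat set \<Rightarrow> (nat \<Rightarrow> nat \<Rightarrow> bool) \<Rightarrow> nat \<Rightarrow> nat set" where
  "nbrs_in W G u = {v \<in> W. G u v}"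

lemma finite_nbrs_in [simp]: "finite W \<Longrightarrow> finite (nbrs_in W G u)"
  by (simp add: nbrs_in_def)

lemma simple_graph_sym: "simple_graph_on N G \<Longrightarrow> u < N \<Longrightarrow> v < N \<Longrightarrow> G u v \<Longrightarrow> G v u"
  by (auto simp: simple_graph_on_def)

lemma simple_graph_irrefl: "simple_graph_on N G \<Longrightarrow> u < N \<Longrightarrow> \<not> G u u"
  by (auto simp: simple_graph_on_def)

lemma card_Diff_singleton_ge: "finite S \<Longrightarrow> k + 1 \<le> card S \<Longrightarrow> k \<le> card (S - {x})"
  by (cases "x \<in> S") auto

lemma two_elements:
  assumes "2 \<le> card S"
  obtains x y where "x \<in> S" "y \<in> S" "x \<noteq> y"
proof -
  have "\<not> card S \<le> Suc 0" using assms by simp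
  moreover have "finite S" using assms card.infinite by fastforce
  ultimately show ?thesis using that by (auto simp: card_le_Suc0_iff_eq)
qed

lemma card_nonempty: "1 \<le> card S \<Longrightarrow> \<exists>x. x \<in> S"
  by (metis card.empty ex_in_conv not_one_le_zero)

subsection \<open>Embedding the trees\<close>

text \<open>An embedding is given by the list of its values: injectivity becomes
  \<open>distinct\<close>, and the image of vertex \<open>a\<close> is the entry at position
  \<open>a\<close>.\<close>

lemma contains_listI:
  assumes "distinct xs" "length xs = h" "set xs \<subseteq> {..<N}"
    and "\<And>a b. (a, b) \<in> E \<Longrightarrow> G (xs ! a) (xs ! b)"
  shows "contains h E N G"
  unfolding contains_def
proof (intro exI conjI)
  show "inj_on ((!) xs) {..<h}"
    using assms(1,2) by (auto simp: inj_on_def nth_eq_iff_index_eq)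
  show "(!) xs ` {..<h} \<subseteq> {..<N}"
    using assms(2,3) nth_mem by blast
  show "\<forall>(u, v)\<in>E. G (xs ! u) (xs ! v)" using assms(4) by auto
qed

lemma obtain_list:
  assumes "finite S" "k \<le> card S"
  obtains ls where "distinct ls" "length ls = k" "set ls \<subseteq> S"
  by (metis assms obtain_subset_with_card_n finite_distinct_list distinct_card)

lemma star_list_edges:
  assumes "(a, b) \<in> star_edges k" "\<And>w. w \<in> set ls \<Longrightarrow> G u w" "k \<le> length ls"
  shows "G ((u # ls @ rs) ! a) ((u # ls @ rs) ! b)"
  using assms by (auto simp: star_edges_def nth_Cons' nth_append)

text \<open>The end vertices \<open>x1\<close>, \<open>x2\<close> may themselves be neighbours of
  \<open>u\<close>, so the leaves of the star are counted in \<open>S - {x1, x2}\<close>. Setting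
  \<open>w1\<close> and \<open>w2\<close> aside leaves \<open>m - 5\<close> further leaves to
  choose. The embedding lemmas for the other trees follow the same pattern.\<close>

lemma contains_T1I:
  assumes "5 \<le> m" "S \<subseteq> {..<N}" "\<And>w. w \<in> S \<Longrightarrow> G u w" "u < N" "u \<notin> S"
    and "w1 \<in> S" "w2 \<in> S" "w1 \<noteq> w2" "x1 < N" "x2 < N" "x1 \<noteq> x2"
    and "x1 \<noteq> u" "x1 \<noteq> w1" "x1 \<noteq> w2" "x2 \<noteq> u" "x2 \<noteq> w1" "x2 \<noteq> w2"
    and edges: "G w1 x1" "G w2 x2" and card: "m - 3 \<le> card (S - {x1, x2})"
  shows "contains m (T1_edges m) N G"
proof -
  have fin: "finite S" using assms(2) finite_subset by blast
  have "card (S - {x1, x2} - {w1, w2}) = card (S - {x1, x2}) - card {w1, w2}"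
    by (rule card_Diff_subset) (use assms in auto)
  then have "m - 5 \<le> card (S - {x1, x2} - {w1, w2})" using card \<open>w1 \<noteq> w2\<close> by simp
  then obtain ls where ls: "distinct ls" "length ls = m - 5" "set ls \<subseteq> S - {x1, x2} - {w1, w2}"
    using fin by (metis obtain_list finite_Diff)
  \<comment> \<open>The order follows the labels of the tree: the centre at 0, \<open>w1\<close> and
    \<open>w2\<close> at positions \<open>m - 4\<close> and \<open>m - 3\<close>, their end vertices
    last.\<close>
  let ?xs = "u # (ls @ [w1, w2]) @ [x1, x2]"
  have nth: "?xs ! (m - 4) = w1" "?xs ! (m - 3) = w2" "?xs ! (m - 2) = x1" "?xs ! (m - 1) = x2"
    using ls(2) assms(1) by (auto simp: nth_Cons' nth_append)
  show ?thesis
  proof (rule contains_listI)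
    show "length ?xs = m" using ls(2) assms(1) by simp
    show "distinct ?xs" "set ?xs \<subseteq> {..<N}" using ls assms by auto
    fix a b assume "(a, b) \<in> T1_edges m"
    then consider "(a, b) \<in> star_edges (m - 3)" | "a = m - 4" "b = m - 2" | "a = m - 3" "b = m - 1"
      by (auto simp: T1_edges_def)
    then show "G (?xs ! a) (?xs ! b)"
    proof cases
      case 1 then show ?thesis
        by (rule star_list_edges) (use ls assms in auto)
    qed (use nth edges in \<open>simp_all only:\<close>)
  qed
qed

lemma contains_T2I:
  assumes "5 \<le> m" "S \<subseteq> {..<N}" "\<And>w. w \<in> S \<Longrightarrow> G u w" "u < N" "u \<notin> S"
    and "w \<in> S" "x < N" "y < N" "x \<noteq> y" "x \<noteq> u" "x \<noteq> w" "y \<noteq> u" "y \<noteq> w"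
    and edges: "G w x" "G w y" and card: "m - 3 \<le> card (S - {x, y})"
  shows "contains m (T2_edges m) N G"
proof -
  have fin: "finite S" using assms(2) finite_subset by blast
  have "card (S - {x, y} - {w}) = card (S - {x, y}) - 1"
    using assms fin by (subst card_Diff_subset) auto
  then have "m - 4 \<le> card (S - {x, y} - {w})" using card by simp
  then obtain ls where ls: "distinct ls" "length ls = m - 4" "set ls \<subseteq> S - {x, y} - {w}"
    using fin by (metis obtain_list finite_Diff)
  let ?xs = "u # (ls @ [w]) @ [x, y]"
  have nth: "?xs ! (m - 3) = w" "?xs ! (m - 2) = x" "?xs ! (m - 1) = y"
    using ls(2) assms(1) by (auto simp: nth_Cons' nth_append)
  show ?thesis
  proof (rule contains_listI)
    show "length ?xs = m" using ls(2) assms(1) by simp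
    show "distinct ?xs" "set ?xs \<subseteq> {..<N}" using ls assms by auto
    fix a b assume "(a, b) \<in> T2_edges m"
    then consider "(a, b) \<in> star_edges (m - 3)" | "a = m - 3" "b = m - 2" | "a = m - 3" "b = m - 1"
      by (auto simp: T2_edges_def)
    then show "G (?xs ! a) (?xs ! b)"
    proof cases
      case 1 then show ?thesis
        by (rule star_list_edges) (use ls assms in auto)
    qed (use nth edges in \<open>simp_all only:\<close>)
  qed
qed

lemma contains_TprimeI:
  assumes "4 \<le> n" "S \<subseteq> {..<N}" "\<And>w. w \<in> S \<Longrightarrow> G u w" "u < N" "u \<notin> S"
    and "w \<in> S" "x < N" "x \<noteq> u" "x \<noteq> w"
    and edges: "G w x" and card: "n - 2 \<le> card (S - {x})"
  shows "contains n (Tprime_edges n) N G"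
proof -
  have fin: "finite S" using assms(2) finite_subset by blast
  have "card (S - {x} - {w}) = card (S - {x}) - 1"
    using assms fin by (subst card_Diff_subset) auto
  then have "n - 3 \<le> card (S - {x} - {w})" using card by simp
  then obtain ls where ls: "distinct ls" "length ls = n - 3" "set ls \<subseteq> S - {x} - {w}"
    using fin by (metis obtain_list finite_Diff)
  let ?xs = "u # (ls @ [w]) @ [x]"
  have nth: "?xs ! (n - 2) = w" "?xs ! (n - 1) = x"
    using ls(2) assms(1) by (auto simp: nth_Cons' nth_append)
  show ?thesis
  proof (rule contains_listI)
    show "length ?xs = n" using ls(2) assms(1) by simp
    show "distinct ?xs" "set ?xs \<subseteq> {..<N}" using ls assms by auto
    fix a b assume "(a, b) \<in> Tprime_edges n"
    then consider "(a, b) \<in> star_edges (n - 2)" | "a = n - 2" "b = n - 1"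
      by (auto simp: Tprime_edges_def)
    then show "G (?xs ! a) (?xs ! b)"
    proof cases
      case 1 then show ?thesis
        by (rule star_list_edges) (use ls assms in auto)
    qed (use nth edges in \<open>simp_all only:\<close>)
  qed
qed

lemma contains_TstarI:
  assumes "4 \<le> n" "S \<subseteq> {..<N}" "\<And>w. w \<in> S \<Longrightarrow> G u w" "u < N" "u \<notin> S"
    and "w \<in> S" "x < N" "y < N" "x \<noteq> y" "x \<noteq> u" "x \<noteq> w" "y \<noteq> u" "y \<noteq> w"
    and edges: "G w x" "G x y" and card: "n - 3 \<le> card (S - {x, y})"
  shows "contains n (Tstar_edges n) N G"
proof -
  have fin: "finite S" using assms(2) finite_subset by blast
  have "card (S - {x, y} - {w}) = card (S - {x, y}) - 1"
    using assms fin by (subst card_Diff_subset) auto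
  then have "n - 4 \<le> card (S - {x, y} - {w})" using card by simp
  then obtain ls where ls: "distinct ls" "length ls = n - 4" "set ls \<subseteq> S - {x, y} - {w}"
    using fin by (metis obtain_list finite_Diff)
  let ?xs = "u # (ls @ [w]) @ [x, y]"
  have nth: "?xs ! (n - 3) = w" "?xs ! (n - 2) = x" "?xs ! (n - 1) = y"
    using ls(2) assms(1) by (auto simp: nth_Cons' nth_append)
  show ?thesis
  proof (rule contains_listI)
    show "length ?xs = n" using ls(2) assms(1) by simp
    show "distinct ?xs" "set ?xs \<subseteq> {..<N}" using ls assms by auto
    fix a b assume "(a, b) \<in> Tstar_edges n"
    then consider "(a, b) \<in> star_edges (n - 3)" | "a = n - 3" "b = n - 2" | "a = n - 2" "b = n - 1"
      by (auto simp: Tstar_edges_def)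
    then show "G (?xs ! a) (?xs ! b)"
    proof cases
      case 1 then show ?thesis
        by (rule star_list_edges) (use ls assms in auto)
    qed (use nth edges in \<open>simp_all only:\<close>)
  qed
qed

subsection \<open>Upper bounds\<close>

text \<open>A neighbour \<open>w\<close> of \<open>u\<close> has two further neighbours
  \<open>x\<close>, \<open>y\<close> besides \<open>u\<close>. If \<open>u\<close> had
  \<open>m - 1\<close> neighbours, \<open>m - 3\<close> of them would remain after removing
  \<open>x\<close> and \<open>y\<close>, giving the tree. The set \<open>W\<close> is kept general
  because the result is applied both to all vertices and to the non-neighbours of one
  vertex.\<close>

lemma T2_free_closed:
  assumes G: "simple_graph_on N G" and m: "5 \<le> m" and W: "W \<subseteq> {..<N}"
    and deg: "\<And>u. u \<in> W \<Longrightarrow> m - 2 \<le> card (nbrs_in W G u)"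
    and free: "\<not> contains m (T2_edges m) N G" and u: "u \<in> W"
  shows "card (nbrs_in W G u) = m - 2"
    and "w \<in> nbrs_in W G u \<Longrightarrow> nbrs_in W G w \<subseteq> insert u (nbrs_in W G u)"
proof -
  have fin: "finite W" using W finite_subset by blast
  let ?S = "nbrs_in W G u"
  have irr: "\<not> G v v" if "v \<in> W" for v using simple_graph_irrefl[OF G] that W by auto
  have no: False if "w \<in> ?S" "x \<in> nbrs_in W G w" "y \<in> nbrs_in W G w" "x \<noteq> y" "x \<noteq> u" "y \<noteq> u"
    "m - 3 \<le> card (?S - {x, y})" for w x y
  proof -
    have "contains m (T2_edges m) N G"
      by (rule contains_T2I[of m ?S _ _ u w x y])
        (use that m W u irr in \<open>auto simp: nbrs_in_def\<close>)
    then show False using free by simp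
  qed
  show c: "card ?S = m - 2"
  proof (rule ccontr)
    assume "card ?S \<noteq> m - 2"
    then have c1: "m - 1 \<le> card ?S" using deg[OF u] by simp
    then have "1 \<le> card ?S" using m by simp
    then obtain w where w: "w \<in> ?S" using card_nonempty by blast
    have "2 \<le> card (nbrs_in W G w - {u})"
      using deg[of w] w m by (intro card_Diff_singleton_ge) (auto simp: nbrs_in_def fin)
    then obtain x y where xy: "x \<in> nbrs_in W G w - {u}" "y \<in> nbrs_in W G w - {u}" "x \<noteq> y"
      using two_elements by blast
    have "m - 3 \<le> card (?S - {x} - {y})"
      using c1 m by (intro card_Diff_singleton_ge) (auto simp: fin)
    then have "m - 3 \<le> card (?S - {x, y})" by (simp add: Diff_insert2[symmetric] insert_commute)
    then show False using no[OF w] xy by blast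
  qed
  assume w: "w \<in> ?S"
  show "nbrs_in W G w \<subseteq> insert u ?S"
  proof (rule ccontr)
    assume "\<not> ?thesis"
    then obtain x where x: "x \<in> nbrs_in W G w" "x \<noteq> u" "x \<notin> ?S" by auto
    have "1 \<le> card (nbrs_in W G w - {u} - {x})"
      using deg[of w] w m by (intro card_Diff_singleton_ge) (auto simp: nbrs_in_def fin)
    then obtain y where y: "y \<in> nbrs_in W G w" "y \<noteq> u" "y \<noteq> x" using card_nonempty by blast
    \<comment> \<open>Only \<open>y\<close> can lie in the neighbourhood of \<open>u\<close>, since
      \<open>x\<close> was chosen outside; so degree \<open>m - 2\<close> already suffices.\<close>
    have "m - 3 \<le> card (?S - {y})" using c m by (intro card_Diff_singleton_ge) (auto simp: fin)
    moreover have "?S - {x, y} = ?S - {y}" using x by auto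
    ultimately show False using no[OF w x(1) y(1)] x y by auto
  qed
qed

text \<open>Fix a path from \<open>u\<close> through \<open>w1\<close> to \<open>x1\<close>. A
  second path from \<open>u\<close> through another neighbour, ending in a new vertex, would
  complete the tree. Hence all other neighbours have very small neighbourhoods, and these force the
  tree in a different position.\<close>

lemma T1_free_closed:
  assumes G: "simple_graph_on N G" and m: "5 \<le> m" and W: "W \<subseteq> {..<N}"
    and deg: "\<And>u. u \<in> W \<Longrightarrow> m - 2 \<le> card (nbrs_in W G u)"
    and free: "\<not> contains m (T1_edges m) N G" and u: "u \<in> W"
  shows "card (nbrs_in W G u) = m - 2"
    and "w \<in> nbrs_in W G u \<Longrightarrow> nbrs_in W G w \<subseteq> insert u (nbrs_in W G u)"
proof -
  have fin: "finite W" using W finite_subset by blast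
  let ?S = "nbrs_in W G u"
  have irr: "\<not> G v v" if "v \<in> W" for v using simple_graph_irrefl[OF G] that W by auto
  have sym: "G y x" if "G x y" "x \<in> W" "y \<in> W" for x y using simple_graph_sym[OF G] that W by auto
  have no: False if "v \<in> W" "w1 \<in> nbrs_in W G v" "w2 \<in> nbrs_in W G v" "w1 \<noteq> w2"
    "x1 \<in> nbrs_in W G w1" "x2 \<in> nbrs_in W G w2" "x1 \<noteq> x2" "x1 \<noteq> v" "x2 \<noteq> v" "x1 \<noteq> w2" "x2 \<noteq> w1"
    "m - 3 \<le> card (nbrs_in W G v - {x1, x2})" for v w1 w2 x1 x2
  proof -
    have "contains m (T1_edges m) N G"
      by (rule contains_T1I[of m "nbrs_in W G v" _ _ v w1 w2 x1 x2])
        (use that m W u irr in \<open>auto simp: nbrs_in_def\<close>)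
    then show False using free by simp
  qed
  \<comment> \<open>Degrees are at least \<open>m - 2 \<ge> 3\<close>, so a neighbourhood confined
    to three named vertices is all of them.\<close>
  have three: "nbrs_in W G w = {x, y, z}" if "w \<in> W" "nbrs_in W G w \<subseteq> {x, y, z}" for w x y z
  proof (rule card_seteq[OF _ that(2)])
    have "card {x, y, z} \<le> 3" by (simp add: card_insert_if)
    then show "card {x, y, z} \<le> card (nbrs_in W G w)" using deg[OF that(1)] m by simp
  qed simp
  show c: "card ?S = m - 2"
  proof (rule ccontr)
    assume "card ?S \<noteq> m - 2"
    then have c1: "m - 1 \<le> card ?S" using deg[OF u] by simp
    have big: "m - 3 \<le> card (?S - {x, y})" for x y
    proof -
      have "m - 3 \<le> card (?S - {x} - {y})"
        using c1 m by (intro card_Diff_singleton_ge) (auto simp: fin)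
      then show ?thesis by (simp add: Diff_insert2[symmetric] insert_commute)
    qed
    have "1 \<le> card ?S" using c1 m by simp
    then obtain w1 where w1: "w1 \<in> ?S" using card_nonempty by blast
    have "1 \<le> card (nbrs_in W G w1 - {u})"
      using deg[of w1] w1 m by (intro card_Diff_singleton_ge) (auto simp: nbrs_in_def fin)
    then obtain x1 where x1: "x1 \<in> nbrs_in W G w1" "x1 \<noteq> u" using card_nonempty by blast
    have "2 \<le> card (?S - {w1, x1})" using big[of w1 x1] m by simp
    then obtain w2 w3 where w: "w2 \<in> ?S - {w1, x1}" "w3 \<in> ?S - {w1, x1}" "w2 \<noteq> w3"
      using two_elements by blast
    have nb: "nbrs_in W G w' = {u, w1, x1}" if w': "w' \<in> ?S - {w1, x1}" for w'
    proof (rule three)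
      show "nbrs_in W G w' \<subseteq> {u, w1, x1}"
        using no[of u w1 w' x1] w1 x1 w' u big by auto
    qed (use w' in \<open>auto simp: nbrs_in_def\<close>)
    have "x1 \<noteq> w1" using x1 irr[of x1] by (auto simp: nbrs_in_def)
    moreover have "w1 \<noteq> u" using w1 irr[OF u] by (auto simp: nbrs_in_def)
    moreover have "w1 \<in> nbrs_in W G w2" "x1 \<in> nbrs_in W G w3" using nb[OF w(1)] nb[OF w(2)] by auto
    \<comment> \<open>Now \<open>w1\<close> and \<open>x1\<close> change roles: they become the end
      vertices behind \<open>w2\<close> and \<open>w3\<close>.\<close>
    ultimately show False using no[of u w2 w3 w1 x1] w x1(2) big[of w1 x1] u by blast
  qed
  assume w1: "w \<in> ?S"
  show "nbrs_in W G w \<subseteq> insert u ?S"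
  proof (rule ccontr)
    assume "\<not> ?thesis"
    then obtain x1 where x1: "x1 \<in> nbrs_in W G w" "x1 \<noteq> u" "x1 \<notin> ?S" by auto
    have big: "m - 3 \<le> card (?S - {x1, y})" for y
    proof -
      have "m - 3 \<le> card (?S - {y})" using c m by (intro card_Diff_singleton_ge) (auto simp: fin)
      moreover have "?S - {x1, y} = ?S - {y}" using x1 by auto
      ultimately show ?thesis by simp
    qed
    have "2 \<le> card (?S - {w})" using c m by (intro card_Diff_singleton_ge) (auto simp: fin)
    then obtain w2 w3 where w: "w2 \<in> ?S - {w}" "w3 \<in> ?S - {w}" "w2 \<noteq> w3"
      using two_elements by blast
    have nb: "nbrs_in W G w' = {u, w, x1}" if w': "w' \<in> ?S - {w}" for w'
    proof (rule three)
      show "nbrs_in W G w' \<subseteq> {u, w, x1}"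
        using no[of u w w' x1] w1 x1 w' u big by auto
    qed (use w' in \<open>auto simp: nbrs_in_def\<close>)
    \<comment> \<open>This only happens for \<open>m = 5\<close>, where the path has to be centred at \<open>x1\<close> instead of \<open>u\<close>.\<close>
    have "card {u, w, x1} \<le> 3" by (simp add: card_insert_if)
    moreover have "w2 \<in> W" using w by (auto simp: nbrs_in_def)
    then have "m - 2 \<le> card {u, w, x1}" using deg[of w2] nb[OF w(1)] by simp
    ultimately have m5: "m = 5" using m by linarith
    have xW: "x1 \<in> W" "w2 \<in> W" "w3 \<in> W" "w \<in> W" using x1 w w1 by (auto simp: nbrs_in_def)
    have "x1 \<in> nbrs_in W G w2" "x1 \<in> nbrs_in W G w3" using nb[OF w(1)] nb[OF w(2)] by auto
    then have x1w: "w2 \<in> nbrs_in W G x1" "w3 \<in> nbrs_in W G x1"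
      using sym xW by (auto simp: nbrs_in_def)
    have uw: "u \<noteq> w" "u \<noteq> w2" "u \<noteq> w3" "x1 \<noteq> w" using w1 w irr[OF u] x1 irr[of w] xW by (auto simp: nbrs_in_def)
    have "card {w2, w3} \<le> card (nbrs_in W G x1 - {u, w})"
      using x1w w uw by (intro card_mono) (auto simp: fin)
    then have "m - 3 \<le> card (nbrs_in W G x1 - {u, w})" using w(3) m5 by simp
    then show False using no[of x1 w2 w3 u w] xW x1w uw w x1 nb[OF w(1)] nb[OF w(2)] by auto
  qed
qed

lemma Tmi_free_closed:
  assumes "simple_graph_on N G" "5 \<le> m" "W \<subseteq> {..<N}"
    and "\<And>u. u \<in> W \<Longrightarrow> m - 2 \<le> card (nbrs_in W G u)"
    and "\<not> contains m (Tmi_edges i m) N G" "u \<in> W"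
  shows "card (nbrs_in W G u) = m - 2"
    and "w \<in> nbrs_in W G u \<Longrightarrow> nbrs_in W G w \<subseteq> insert u (nbrs_in W G u)"
  using T1_free_closed[OF assms(1-4) _ assms(6)] T2_free_closed[OF assms(1-4) _ assms(6)] assms(5)
  by (auto simp: Tmi_edges_def split: if_splits)

text \<open>Otherwise each closed neighbourhood has \<open>m - 1\<close> elements and contains the
  closed neighbourhoods of its members. Equal size turns these inclusions into equalities, so the
  closed neighbourhoods partition the vertices into blocks of size \<open>m - 1\<close>.\<close>

lemma Tmi_free_low_degree:
  assumes G: "simple_graph_on N G" and m: "5 \<le> m" and ndvd: "\<not> (m - 1) dvd N"
    and free: "\<not> contains m (Tmi_edges i m) N G"
  shows "\<exists>v<N. card (nbrs_in {..<N} G v) \<le> m - 3"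
proof (rule ccontr)
  let ?nb = "nbrs_in {..<N} G"
  let ?C = "\<lambda>u. insert u (?nb u)"
  assume "\<not> ?thesis"
  then have deg: "m - 2 \<le> card (?nb u)" if "u \<in> {..<N}" for u using that by force
  note cl = Tmi_free_closed[OF G m _ deg free, simplified]
  have card: "card (?C u) = m - 1" if "u < N" for u
    using cl(1)[OF that] simple_graph_irrefl[OF G that] m by (auto simp: nbrs_in_def)
  have eq: "?C w = ?C u" if "u < N" "w \<in> ?C u" for u w
  proof (rule card_seteq)
    have "w < N" using that by (auto simp: nbrs_in_def)
    then show "card (?C u) \<le> card (?C w)" using card that by simp
    show "?C w \<subseteq> ?C u" using cl(2)[OF that(1), of w] that(2) by auto
  qed simp
  have "(m - 1) dvd card (\<Union>(?C ` {..<N}))"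
  proof (rule dvd_partition)
    show "\<forall>c1\<in>?C ` {..<N}. \<forall>c2\<in>?C ` {..<N}. c1 \<noteq> c2 \<longrightarrow> c1 \<inter> c2 = {}"
    proof (intro ballI impI)
      fix c1 c2 assume "c1 \<in> ?C ` {..<N}" "c2 \<in> ?C ` {..<N}" and ne: "c1 \<noteq> c2"
      then obtain u v where uv: "u < N" "v < N" "c1 = ?C u" "c2 = ?C v" by auto
      show "c1 \<inter> c2 = {}"
      proof (rule ccontr)
        assume "c1 \<inter> c2 \<noteq> {}"
        then obtain x where "x \<in> c1" "x \<in> c2" by blast
        then show False using eq[of u x] eq[of v x] uv ne by simp
      qed
    qed
  qed (use card in auto)
  moreover have "\<Union>(?C ` {..<N}) = {..<N}" by (auto simp: nbrs_in_def)
  ultimately show False using ndvd by simp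
qed

section \<open>The trees in the complement, centred at a vertex of low degree\<close>

lemma contains_Tmi_two_level:
  assumes m: "5 \<le> m" and v: "v < N" and A: "A \<subseteq> {..<N}" and B: "B \<subseteq> {..<N}"
    and disj: "A \<inter> B = {}" "v \<notin> A" "v \<notin> B" and vB: "\<And>y. y \<in> B \<Longrightarrow> G v y"
    and card: "m - 3 \<le> card B" and two: "\<And>y. y \<in> B \<Longrightarrow> 2 \<le> card (nbrs_in A G y)"
  shows "contains m (Tmi_edges i m) N G"
proof -
  have "2 \<le> card B" using card m by simp
  then obtain b1 b2 where b: "b1 \<in> B" "b2 \<in> B" "b1 \<noteq> b2" using two_elements by blast
  obtain a1 a2 where a: "a1 \<in> nbrs_in A G b1" "a2 \<in> nbrs_in A G b1" "a1 \<noteq> a2"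
    using two_elements[OF two[OF b(1)]] by blast
  obtain a3 a4 where a': "a3 \<in> nbrs_in A G b2" "a4 \<in> nbrs_in A G b2" "a3 \<noteq> a4"
    using two_elements[OF two[OF b(2)]] by blast
  \<comment> \<open>Two neighbours of \<open>b2\<close> are enough to avoid \<open>a1\<close>. All
    end vertices lie in \<open>A\<close>, so the star into \<open>B\<close> loses no leaf.\<close>
  obtain a5 where a5: "a5 \<in> nbrs_in A G b2" "a5 \<noteq> a1" using a' by metis
  have B1: "B - {a1, a2} = B" and B2: "B - {a1, a5} = B"
    using a a5 disj by (auto simp: nbrs_in_def)
  have "contains m (T1_edges m) N G"
    by (rule contains_T1I[of m B _ _ v b1 b2 a1 a5])
      (use b a a5 B1 B2 assms in \<open>auto simp: nbrs_in_def\<close>)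
  moreover have "contains m (T2_edges m) N G"
    by (rule contains_T2I[of m B _ _ v b1 a1 a2])
      (use b a a5 B1 B2 assms in \<open>auto simp: nbrs_in_def\<close>)
  ultimately show ?thesis by (simp add: Tmi_edges_def)
qed

lemma complement_nbrs:
  "nbrs_in {..<N} (complement G) v = {..<N} - insert v (nbrs_in {..<N} G v)"
  by (auto simp: nbrs_in_def complement_def)

lemma card_complement_nbrs:
  assumes "simple_graph_on N G" "v < N"
  shows "card (nbrs_in {..<N} (complement G) v) = N - 1 - card (nbrs_in {..<N} G v)"
proof -
  have "v \<notin> nbrs_in {..<N} G v" using simple_graph_irrefl[OF assms] by (simp add: nbrs_in_def)
  then show ?thesis unfolding complement_nbrs
    using assms(2) by (subst card_Diff_subset) (auto simp: nbrs_in_def)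
qed

text \<open>Without such a path the complement is a matching on \<open>A\<close>, so degrees inside
  \<open>A\<close> are at least \<open>m - 2\<close> and closed neighbourhoods have only
  \<open>m - 1\<close> elements. Some \<open>x\<close> is then not adjacent to \<open>u\<close>, yet
  a third vertex \<open>w\<close> is adjacent to both, which contradicts closedness.\<close>

lemma path_in_complement:
  assumes G: "simple_graph_on N G" and m: "5 \<le> m" and A: "A \<subseteq> {..<N}" and cA: "m \<le> card A"
    and free: "\<not> contains m (Tmi_edges i m) N G"
  shows "\<exists>x\<in>A. \<exists>y\<in>A. \<exists>z\<in>A. x \<noteq> y \<and> y \<noteq> z \<and> x \<noteq> z \<and> \<not> G x y \<and> \<not> G y z"
proof (rule ccontr)
  assume "\<not> ?thesis"
  then have uniq: "x = z" if "x \<in> A" "y \<in> A" "z \<in> A" "x \<noteq> y" "y \<noteq> z" "\<not> G x y" "\<not> G y z" for x y z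
    using that by blast
  have fin: "finite A" using A finite_subset by blast
  have sym: "G y x" if "G x y" "x \<in> A" "y \<in> A" for x y using simple_graph_sym[OF G] that A by auto
  have deg: "m - 2 \<le> card (nbrs_in A G u)" if u: "u \<in> A" for u
  proof -
    obtain x where "A - {u} - {x} \<subseteq> nbrs_in A G u"
    proof (cases "\<exists>x\<in>A - {u}. \<not> G u x")
      case True
      then obtain x where x: "x \<in> A - {u}" "\<not> G u x" by blast
      have "A - {u} - {x} \<subseteq> nbrs_in A G u" using uniq[of x u] x u sym by (auto simp: nbrs_in_def)
      then show ?thesis using that by blast
    next
      case False
      then show ?thesis using that[of u] by (auto simp: nbrs_in_def)
    qed
    moreover have "m - 2 \<le> card (A - {u} - {x})"
      using m cA by (intro card_Diff_singleton_ge) (auto simp: fin)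
    ultimately show ?thesis using card_mono[of "nbrs_in A G u"] fin by (meson finite_nbrs_in le_trans)
  qed
  have "1 \<le> card A" using cA m by simp
  then obtain u where u: "u \<in> A" using card_nonempty by blast
  have cl1: "card (nbrs_in A G u) = m - 2"
    by (rule Tmi_free_closed(1)[OF G m A _ free u]) (rule deg)
  have cl2: "nbrs_in A G w \<subseteq> insert u (nbrs_in A G u)" if "w \<in> nbrs_in A G u" for w
    by (rule Tmi_free_closed(2)[OF G m A _ free u that]) (rule deg)
  have cC: "card (insert u (nbrs_in A G u)) \<le> m - 1"
    using cl1 m by (auto simp: card_insert_if fin)
  have "\<not> A \<subseteq> insert u (nbrs_in A G u)"
  proof
    assume "A \<subseteq> insert u (nbrs_in A G u)"
    then have "card A \<le> card (insert u (nbrs_in A G u))" by (intro card_mono) (auto simp: fin)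
    then show False using cC cA m by simp
  qed
  then obtain x where x: "x \<in> A" "x \<noteq> u" "\<not> G u x" by (auto simp: nbrs_in_def)
  have "1 \<le> card (A - {u} - {x})" using m cA by (intro card_Diff_singleton_ge) (auto simp: fin)
  then obtain w where w: "w \<in> A" "w \<noteq> u" "w \<noteq> x" using card_nonempty by blast
  have "G u w" using uniq[of x u w] x u w sym by blast
  moreover have "G w x" using uniq[of u x w] x u w sym by blast
  ultimately show False using cl2[of w] w x by (auto simp: nbrs_in_def)
qed

text \<open>If \<open>v\<close> has at most \<open>m - 4\<close> neighbours, there are at least
  \<open>n - 1\<close> non-neighbours, enough to spend some of them on a complement path. If it has
  \<open>m - 3\<close>, the \<open>n - 2\<close> non-neighbours are all needed as leaves for
  \<open>T'\<close>, and the path must leave \<open>A\<close> through a neighbour \<open>y\<close>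
  of \<open>v\<close>.\<close>

lemma low_degree_imp_contains:
  assumes G: "simple_graph_on N G" and m: "5 \<le> m" "m < n" and N: "N = m + n - 4"
    and free: "\<not> contains m (Tmi_edges i m) N G"
    and v: "v < N" "card (nbrs_in {..<N} G v) \<le> m - 3"
  shows "contains n (Tprime_edges n) N (complement G) \<and> contains n (Tstar_edges n) N (complement G)"
proof -
  let ?H = "complement G"
  define A where "A = nbrs_in {..<N} ?H v"
  define B where "B = nbrs_in {..<N} G v"
  have cA: "card A = N - 1 - card B" unfolding A_def B_def by (rule card_complement_nbrs[OF G v(1)])
  have AN: "A \<subseteq> {..<N}" and BN: "B \<subseteq> {..<N}" and vA: "v \<notin> A" and vB: "v \<notin> B"
    and HA: "\<And>w. w \<in> A \<Longrightarrow> ?H v w" and GB: "\<And>w. w \<in> B \<Longrightarrow> G v w" and disj: "A \<inter> B = {}"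
    using simple_graph_irrefl[OF G v(1)]
    by (auto simp: A_def B_def nbrs_in_def complement_def)
  have fin: "finite A" using AN finite_subset by blast
  have sym: "G y x" if "G x y" "x < N" "y < N" for x y using simple_graph_sym[OF G] that by auto
  note TpI = contains_TprimeI[of n A N ?H v, OF _ AN HA v(1) vA]
  note TsI = contains_TstarI[of n A N ?H v, OF _ AN HA v(1) vA]
  show ?thesis
  proof (cases "card B \<le> m - 4")
    case True
    then have c: "n - 1 \<le> card A" using cA N m by simp
    then have "m \<le> card A" using m by simp
    from path_in_complement[OF G m(1) AN this free] obtain x y z where
      xyz: "x \<in> A" "y \<in> A" "z \<in> A" "x \<noteq> y" "y \<noteq> z" "x \<noteq> z" "\<not> G x y" "\<not> G y z"
      by blast
    have c1: "n - 2 \<le> card (A - {y})" using c m by (intro card_Diff_singleton_ge) (auto simp: fin)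
    have "n - 3 \<le> card (A - {y} - {z})" using c m by (intro card_Diff_singleton_ge) (auto simp: fin)
    then have c2: "n - 3 \<le> card (A - {y, z})" by (simp add: Diff_insert2[symmetric] insert_commute)
    have "contains n (Tprime_edges n) N ?H"
      by (rule TpI[of x y]) (use xyz c1 AN vA m in \<open>auto simp: complement_def\<close>)
    moreover have "contains n (Tstar_edges n) N ?H"
      by (rule TsI[of x y z]) (use xyz c2 AN vA m in \<open>auto simp: complement_def\<close>)
    ultimately show ?thesis by simp
  next
    case False
    then have cB: "card B = m - 3" using v(2) by (simp add: B_def)
    then have cA: "card A = n - 2" using cA N m by simp
    \<comment> \<open>If every neighbour of \<open>v\<close> had two neighbours in \<open>A\<close>,
      the graph would contain \<open>T\<^sub>m\<^sup>i\<close> centred at \<open>v\<close>.\<close>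
    obtain y where y: "y \<in> B" "card (nbrs_in A G y) < 2"
      using contains_Tmi_two_level[where G = G and A = A and B = B and i = i, OF m(1) v(1) AN BN disj vA vB]
        GB cB free by force
    have "nbrs_in A G y \<union> nbrs_in A ?H y = A"
      using y(1) disj by (auto simp: nbrs_in_def complement_def)
    then have "card A \<le> card (nbrs_in A G y) + card (nbrs_in A ?H y)"
      by (metis card_Un_le)
    then have "2 \<le> card (nbrs_in A ?H y)" using y(2) cA m by simp
    then obtain x z where xz: "x \<in> nbrs_in A ?H y" "z \<in> nbrs_in A ?H y" "x \<noteq> z"
      using two_elements by blast
    have xz': "x \<in> A" "z \<in> A" "?H x y" "?H y z" "x \<noteq> y" "z \<noteq> y" "y < N"
      using xz y BN AN sym by (auto simp: nbrs_in_def complement_def)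
    have yA: "A - {y} = A" "A - {y, z} = A - {z}" using y disj by auto
    have c2: "n - 3 \<le> card (A - {z})" using cA m by (intro card_Diff_singleton_ge) (auto simp: fin)
    have "contains n (Tprime_edges n) N ?H"
      by (rule TpI[of x y]) (use xz' y vB yA cA AN vA m in auto)
    moreover have "contains n (Tstar_edges n) N ?H"
      by (rule TsI[of x y z]) (use xz' xz(3) y vB yA c2 AN vA m in auto)
    ultimately show ?thesis by simp
  qed
qed

section \<open>Ramsey numbers as least values\<close>

definition ramsey_at :: "nat \<Rightarrow> (nat \<times> nat) set \<Rightarrow> nat \<Rightarrow> (nat \<times> nat) set \<Rightarrow> nat \<Rightarrow> bool" where
  "ramsey_at h1 E1 h2 E2 N \<longleftrightarrow> 0 < N \<and> (\<forall>G. simple_graph_on N G \<longrightarrow>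
         contains h1 E1 N G \<or> contains h2 E2 N (complement G))"

lemma ramsey_at_upper:
  assumes "5 \<le> m" "m < n" "\<not> (m - 1) dvd (n - 3)"
  shows "ramsey_at m (Tmi_edges i m) n (Tprime_edges n) (m + n - 4)"
    and "ramsey_at m (Tmi_edges i m) n (Tstar_edges n) (m + n - 4)"
proof -
  have "m + n - 4 = (m - 1) + (n - 3)" using assms by simp
  then have "\<not> (m - 1) dvd (m + n - 4)" using assms(3) by (metis dvd_add_right_iff dvd_refl)
  then show "ramsey_at m (Tmi_edges i m) n (Tprime_edges n) (m + n - 4)"
    and "ramsey_at m (Tmi_edges i m) n (Tstar_edges n) (m + n - 4)"
    unfolding ramsey_at_def
    using Tmi_free_low_degree low_degree_imp_contains assms(1,2) by fastforce+
qed

lemma ramsey_number_le: "ramsey_at h1 E1 h2 E2 N \<Longrightarrow> ramsey_number h1 E1 h2 E2 \<le> N"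
  unfolding ramsey_number_def ramsey_at_def by (rule Least_le)

lemma contains_mono: "contains h E N G \<Longrightarrow> N \<le> N' \<Longrightarrow> contains h E N' G"
  unfolding contains_def by (meson lessThan_subset_iff order_trans)

text \<open>The number \<open>M\<close> ensures that the least value is attained. Were it at most
  \<open>N\<close>, the restriction of \<open>G\<close> to that many vertices would yield one of the
  two trees, hence so would \<open>G\<close>.\<close>

lemma ramsey_number_gt:
  assumes "ramsey_at h1 E1 h2 E2 M" "simple_graph_on N G"
    and "\<not> contains h1 E1 N G" "\<not> contains h2 E2 N (complement G)"
  shows "N < ramsey_number h1 E1 h2 E2"
proof (rule ccontr)
  let ?R = "ramsey_number h1 E1 h2 E2"
  assume "\<not> ?thesis"
  then have le: "?R \<le> N" by simp
  have "ramsey_at h1 E1 h2 E2 ?R"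
    using assms(1) unfolding ramsey_number_def ramsey_at_def by (rule LeastI)
  moreover have "simple_graph_on ?R G" using assms(2) le by (auto simp: simple_graph_on_def)
  ultimately show False using assms(3,4) le contains_mono by (metis ramsey_at_def)
qed

subsection \<open>Lower bounds\<close>

text \<open>Either disjunct keeps a vertex from being the centre of \<open>T\<^sub>m\<^sup>i\<close>: its degree is too small,
  or its component is a clique with fewer than \<open>m\<close> vertices.\<close>

definition good :: "nat \<Rightarrow> nat \<Rightarrow> nat \<Rightarrow> (nat \<Rightarrow> nat \<Rightarrow> bool) \<Rightarrow> bool" where
  "good m d N G \<longleftrightarrow> simple_graph_on N G \<and> (\<forall>u<N. d \<le> card (nbrs_in {..<N} G u) \<and>
     (card (nbrs_in {..<N} G u) \<le> m - 4 \<or> card (nbrs_in {..<N} G u) \<le> m - 2 \<and>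
       (\<forall>w\<in>nbrs_in {..<N} G u. insert w (nbrs_in {..<N} G w) = insert u (nbrs_in {..<N} G u))))"

lemma containsE:
  assumes "contains h E N G"
  obtains f where "inj_on f {..<h}" "f ` {..<h} \<subseteq> {..<N}" "\<And>u v. (u, v) \<in> E \<Longrightarrow> G (f u) (f v)"
proof -
  obtain f where f: "inj_on f {..<h}" "f ` {..<h} \<subseteq> {..<N}" "\<forall>(u, v)\<in>E. G (f u) (f v)"
    using assms unfolding contains_def by (elim exE conjE)
  then show ?thesis by (intro that[of f]) auto
qed

lemma star_edges_degree:
  assumes "inj_on f {..<h}" "f ` {..<h} \<subseteq> {..<N}" "k < h"
    and "\<And>j. 1 \<le> j \<Longrightarrow> j \<le> k \<Longrightarrow> G (f 0) (f j)"
  shows "f ` {1..k} \<subseteq> nbrs_in {..<N} G (f 0)" and "card (f ` {1..k}) = k"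
    and "k \<le> card (nbrs_in {..<N} G (f 0))"
proof -
  show 1: "f ` {1..k} \<subseteq> nbrs_in {..<N} G (f 0)"
    using assms by (auto simp: nbrs_in_def image_subset_iff)
  show 2: "card (f ` {1..k}) = k"
    using assms(3) by (subst card_image[OF inj_on_subset[OF assms(1)]]) auto
  show "k \<le> card (nbrs_in {..<N} G (f 0))" using card_mono[OF _ 1] 2 by simp
qed

text \<open>The centre has degree at least \<open>m - 3\<close>, so the clique alternative of
  \<open>good\<close> applies to it. Every vertex of the tree is within distance two of the centre
  and therefore lies in that clique, which has fewer than \<open>m\<close> vertices.\<close>

lemma good_Tmi_free:
  assumes good: "good m d N G" and m: "5 \<le> m"
  shows "\<not> contains m (Tmi_edges i m) N G"
proof
  assume "contains m (Tmi_edges i m) N G"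
  then obtain f where inj: "inj_on f {..<m}" and sub: "f ` {..<m} \<subseteq> {..<N}"
    and E: "\<And>u v. (u, v) \<in> Tmi_edges i m \<Longrightarrow> G (f u) (f v)"
    by (rule containsE) blast
  have star: "G (f 0) (f j)" if "1 \<le> j" "j \<le> m - 3" for j
    using that by (intro E) (auto simp: Tmi_edges_def T1_edges_def T2_edges_def star_edges_def)
  let ?S = "nbrs_in {..<N} G (f 0)"
  let ?C = "insert (f 0) ?S"
  have "m - 3 \<le> card ?S"
    by (rule star_edges_degree(3)[OF inj sub]) (use m star in auto)
  then have "\<not> card ?S \<le> m - 4" using m by linarith
  moreover have "f 0 < N" using sub m by (simp add: image_subset_iff)
  ultimately have cS: "card ?S \<le> m - 2"
    and cl: "\<And>w. w \<in> ?S \<Longrightarrow> insert w (nbrs_in {..<N} G w) = ?C"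
    using good unfolding good_def by blast+
  have leaf: "f j \<in> ?C" if "j \<le> m - 3" for j
    using star[of j] sub that m by (cases "j = 0") (auto simp: nbrs_in_def image_subset_iff)
  have step: "f j \<in> ?C" if "G (f l) (f j)" "1 \<le> l" "l \<le> m - 3" "j < m" for l j
  proof -
    have "f l \<in> ?S" using star[of l] sub that m by (auto simp: nbrs_in_def image_subset_iff)
    moreover have "f j \<in> nbrs_in {..<N} G (f l)" using that sub by (auto simp: nbrs_in_def image_subset_iff)
    ultimately show ?thesis using cl by blast
  qed
  have "(m - 4, m - 2) \<in> Tmi_edges i m \<or> (m - 3, m - 2) \<in> Tmi_edges i m"
    "(m - 3, m - 1) \<in> Tmi_edges i m"
    by (auto simp: Tmi_edges_def T1_edges_def T2_edges_def)
  then have "G (f (m - 4)) (f (m - 2)) \<or> G (f (m - 3)) (f (m - 2))" "G (f (m - 3)) (f (m - 1))"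
    using E by blast+
  then have "f (m - 2) \<in> ?C" "f (m - 1) \<in> ?C"
    using step[of "m - 4" "m - 2"] step[of "m - 3" "m - 2"] step[of "m - 3" "m - 1"] m by auto
  moreover have "j \<le> m - 3 \<or> j = m - 2 \<or> j = m - 1" if "j < m" for j using that by presburger
  ultimately have "f ` {..<m} \<subseteq> ?C" using leaf by (metis image_subsetI lessThan_iff)
  then have "card (f ` {..<m}) \<le> card ?C" by (intro card_mono) auto
  also have "\<dots> \<le> m - 1" using cS m by (auto simp: card_insert_if)
  finally show False using card_image[OF inj] m by simp
qed

lemma good_complement_degree:
  assumes "good m d N G" "v < N"
  shows "card (nbrs_in {..<N} (complement G) v) \<le> N - 1 - d"
  using assms card_complement_nbrs[of N G v] by (auto simp: good_def)

lemma good_complement_Tprime_free: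
  assumes "good m d N G" "N \<le> d + n - 2" "4 \<le> n"
  shows "\<not> contains n (Tprime_edges n) N (complement G)"
proof
  assume "contains n (Tprime_edges n) N (complement G)"
  then obtain f where inj: "inj_on f {..<n}" and sub: "f ` {..<n} \<subseteq> {..<N}"
    and E: "\<And>u v. (u, v) \<in> Tprime_edges n \<Longrightarrow> complement G (f u) (f v)"
    by (rule containsE) blast
  have "n - 2 \<le> card (nbrs_in {..<N} (complement G) (f 0))"
    by (rule star_edges_degree[OF inj sub]) (use assms in \<open>auto intro!: E simp: Tprime_edges_def star_edges_def\<close>)
  moreover have "f 0 < N" using sub assms by (simp add: image_subset_iff)
  ultimately show False using good_complement_degree[OF assms(1), of "f 0"] assms(2,3) by simp
qed

text \<open>The star in \<open>T*\<close> has one leaf fewer than that in \<open>T'\<close>, so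
  counting degrees alone costs one vertex of the graph. The second alternative saves this vertex:
  with all degrees above \<open>m - 4\<close>, every vertex lies in a clique component.\<close>

lemma good_complement_Tstar_free:
  assumes good: "good m d N G" and N: "N + 1 \<le> d + n - 2 \<or> N \<le> d + n - 2 \<and> m - 4 < d" and n: "4 \<le> n"
  shows "\<not> contains n (Tstar_edges n) N (complement G)"
proof
  let ?H = "complement G"
  assume "contains n (Tstar_edges n) N ?H"
  then obtain f where inj: "inj_on f {..<n}" and sub: "f ` {..<n} \<subseteq> {..<N}"
    and E: "\<And>u v. (u, v) \<in> Tstar_edges n \<Longrightarrow> ?H (f u) (f v)"
    by (rule containsE) blast
  have star: "?H (f 0) (f j)" if "1 \<le> j" "j \<le> n - 3" for j
    using that by (intro E) (auto simp: Tstar_edges_def star_edges_def)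
  let ?A = "nbrs_in {..<N} ?H (f 0)"
  have f0: "f 0 < N" using sub n by (simp add: image_subset_iff)
  have le: "card ?A \<le> N - 1 - d" using good_complement_degree[OF good f0] .
  have ge: "n - 3 \<le> card ?A" by (rule star_edges_degree(3)[OF inj sub]) (use n star in auto)
  \<comment> \<open>Under the first alternative, \<open>le\<close> and \<open>ge\<close> contradict
    each other.\<close>
  then have d: "N \<le> d + n - 2" "m - 4 < d" using le N n by auto
  \<comment> \<open>The centre has no neighbours besides the leaves of its star, so the last two vertices of the
    path lie in the clique of the centre and cannot be adjacent in the complement.\<close>
  have "f ` {1..n - 3} = ?A"
  proof (rule card_seteq)
    show "f ` {1..n - 3} \<subseteq> ?A" by (rule star_edges_degree(1)[OF inj sub]) (use n star in auto)
    have "card (f ` {1..n - 3}) = n - 3" 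
      by (rule star_edges_degree(2)[OF inj sub, where G = ?H]) (use n star in auto)
    then show "card ?A \<le> card (f ` {1..n - 3})" using le d n by simp
  qed simp
  then have inG: "f j \<in> nbrs_in {..<N} G (f 0)" if j: "n - 2 \<le> j" "j < n" for j
  proof -
    have "f j \<noteq> f l" if "l \<le> n - 3" for l
    proof -
      have "l < n" "j \<noteq> l" using that j n by linarith+
      then show ?thesis using inj j(2) by (auto dest: inj_onD)
    qed
    then have "f j \<notin> f ` {1..n - 3}" "f j \<noteq> f 0" by (fastforce simp: image_iff, blast)
    moreover have "f j < N" using sub j by (simp add: image_subset_iff)
    ultimately show ?thesis using \<open>f ` {1..n - 3} = ?A\<close> by (auto simp: nbrs_in_def complement_def)
  qed
  have cl: "insert w (nbrs_in {..<N} G w) = insert (f 0) (nbrs_in {..<N} G (f 0))"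
    if "w \<in> nbrs_in {..<N} G (f 0)" for w
  proof -
    have "m - 4 < card (nbrs_in {..<N} G (f 0))"
      using good f0 d(2) unfolding good_def by (meson less_le_trans)
    then show ?thesis using good f0 that unfolding good_def by (meson not_less)
  qed
  have "?H (f (n - 2)) (f (n - 1))" by (rule E) (auto simp: Tstar_edges_def)
  moreover have "f (n - 1) \<in> insert (f (n - 2)) (nbrs_in {..<N} G (f (n - 2)))"
    using cl[OF inG[of "n - 2"]] inG[of "n - 1"] n by auto
  ultimately show False by (auto simp: complement_def nbrs_in_def)
qed

section \<open>Disjoint unions and cliques\<close>

definition disjoint_union ::
  "nat \<Rightarrow> (nat \<Rightarrow> nat \<Rightarrow> bool) \<Rightarrow> (nat \<Rightarrow> nat \<Rightarrow> bool) \<Rightarrow> nat \<Rightarrow> nat \<Rightarrow> bool" where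
  "disjoint_union N G H u v \<longleftrightarrow>
     u < N \<and> v < N \<and> G u v \<or> N \<le> u \<and> N \<le> v \<and> H (u - N) (v - N)"

lemma nbrs_disjoint_union_left:
  "u < N \<Longrightarrow> nbrs_in {..<N + M} (disjoint_union N G H) u = nbrs_in {..<N} G u"
  by (auto simp: nbrs_in_def disjoint_union_def)

lemma nbrs_disjoint_union_right:
  "nbrs_in {..<N + M} (disjoint_union N G H) (N + u) = (+) N ` nbrs_in {..<M} H u"
proof -
  have "x \<in> (+) N ` nbrs_in {..<M} H u"
    if "x \<in> nbrs_in {..<N + M} (disjoint_union N G H) (N + u)" for x
    using that by (intro image_eqI[of _ _ "x - N"]) (auto simp: nbrs_in_def disjoint_union_def)
  then show ?thesis by (auto simp: nbrs_in_def disjoint_union_def)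
qed

text \<open>All conditions in \<open>good\<close> concern a vertex and its neighbours, which stay
  inside one summand; the second summand is merely shifted by \<open>N\<close>.\<close>

lemma good_disjoint_union:
  assumes "good m d N G" "good m d M H"
  shows "good m d (N + M) (disjoint_union N G H)"
proof -
  let ?U = "disjoint_union N G H"
  let ?P = "\<lambda>N G u. d \<le> card (nbrs_in {..<N} G u) \<and>
     (card (nbrs_in {..<N} G u) \<le> m - 4 \<or> card (nbrs_in {..<N} G u) \<le> m - 2 \<and>
       (\<forall>w\<in>nbrs_in {..<N} G u. insert w (nbrs_in {..<N} G w) = insert u (nbrs_in {..<N} G u)))"
  have "?P (N + M) ?U u" if u: "u < N + M" for u
  proof (cases "u < N")
    case True
    have "nbrs_in {..<N + M} ?U w = nbrs_in {..<N} G w" if "w \<in> nbrs_in {..<N} G u" for w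
      by (rule nbrs_disjoint_union_left) (use that in \<open>simp add: nbrs_in_def\<close>)
    moreover have "?P N G u" using assms(1) True unfolding good_def by blast
    ultimately show ?thesis unfolding nbrs_disjoint_union_left[OF True] by simp
  next
    case False
    then obtain u' where u': "u = N + u'" "u' < M" using u by (metis add_less_cancel_left le_Suc_ex not_less)
    have "?P M H u'" using assms(2) u' unfolding good_def by blast
    then show ?thesis
      unfolding u'(1) nbrs_disjoint_union_right
      by (auto simp: card_image nbrs_disjoint_union_right simp flip: image_insert)
  qed
  moreover have "simple_graph_on (N + M) ?U"
    using assms by (auto simp: good_def simple_graph_on_def disjoint_union_def)
  ultimately show ?thesis unfolding good_def by blast
qed

lemma good_clique:
  assumes "d < p" "p < m"
  shows "good m d p (\<noteq>)"
proof -
  have "nbrs_in {..<p} (\<noteq>) u = {..<p} - {u}" for u by (auto simp: nbrs_in_def)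
  then show ?thesis using assms by (auto simp: good_def simple_graph_on_def nbrs_in_def insert_absorb)
qed

lemma good_cliques:
  assumes "5 \<le> m"
  shows "\<exists>G. good m (m - 3) (s * (m - 1) + t * (m - 2)) G"
proof -
  have t: "\<exists>G. good m (m - 3) (t * (m - 2)) G"
  proof (induction t)
    case 0 show ?case by (simp add: good_def simple_graph_on_def)
  next
    case (Suc t)
    then obtain G where G: "good m (m - 3) (t * (m - 2)) G" by blast
    have "good m (m - 3) (m - 2) (\<noteq>)" by (rule good_clique) (use assms in auto)
    from good_disjoint_union[OF this G] show ?case by auto
  qed
  show ?thesis
  proof (induction s)
    case 0 show ?case using t by simp
  next
    case (Suc s)
    then obtain G where G: "good m (m - 3) (s * (m - 1) + t * (m - 2)) G" by blast
    have "good m (m - 3) (m - 1) (\<noteq>)" by (rule good_clique) (use assms in auto)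
    from good_disjoint_union[OF this G] show ?case by (auto simp: add.assoc)
  qed
qed

section \<open>Regular graphs from circulants\<close>

definition circulant :: "nat \<Rightarrow> nat set \<Rightarrow> nat \<Rightarrow> nat \<Rightarrow> bool" where
  "circulant M S u v \<longleftrightarrow> (u + M - v) mod M \<in> S"

text \<open>Adding \<open>M\<close> before subtracting keeps the truncated difference of naturals
  faithful to the difference modulo \<open>M\<close>.\<close>

lemma circulant_diff:
  fixes u v M :: nat
  assumes "u < M" "v < M"
  shows "(u + M - v) mod M = (if v \<le> u then u - v else u + M - v)"
proof (cases "v \<le> u")
  case True
  then have "u + M - v = (u - v) + M" by arith
  then have "(u + M - v) mod M = (u - v) mod M" by (metis mod_add_self2)
  then show ?thesis using True assms by simp
qed (use assms in simp)

lemma simple_circulant: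
  assumes "S \<subseteq> {1..<M}" "\<And>s. s \<in> S \<Longrightarrow> M - s \<in> S"
  shows "simple_graph_on M (circulant M S)"
proof -
  have "circulant M S v u" if uv: "u < M" "v < M" and c: "circulant M S u v" for u v
  proof -
    have "0 \<notin> S" using assms(1) by auto
    then have "u \<noteq> v" using c uv by (auto simp: circulant_def)
    then have "(v + M - u) mod M = M - (u + M - v) mod M"
      using uv by (auto simp: circulant_diff)
    then show ?thesis using assms(2) c by (simp add: circulant_def)
  qed
  moreover have "\<not> circulant M S u u" if "u < M" for u
    using assms(1) that by (auto simp: circulant_def)
  ultimately show ?thesis unfolding simple_graph_on_def by blast
qed

lemma circulant_degree:
  assumes "S \<subseteq> {1..<M}" "u < M"
  shows "card (nbrs_in {..<M} (circulant M S) u) = card S"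
proof (rule bij_betw_same_card[symmetric])
  \<comment> \<open>Reflection at \<open>u\<close> modulo \<open>M\<close> is an involution, so it
    serves as its own inverse in the bijection.\<close>
  have inv: "(u + M - (u + M - s) mod M) mod M = s" if "s < M" for s
    using that assms(2) by (auto simp: circulant_diff)
  show "bij_betw (\<lambda>s. (u + M - s) mod M) S (nbrs_in {..<M} (circulant M S) u)"
    by (rule bij_betw_byWitness[where f' = "\<lambda>v. (u + M - v) mod M"])
      (use assms inv in \<open>auto simp: nbrs_in_def circulant_def subset_iff\<close>)
qed

lemma symmetric_residues:
  assumes "d < M" "even (d * M)"
  shows "\<exists>S\<subseteq>{1..<M}. card S = d \<and> (\<forall>s\<in>S. M - s \<in> S)"
proof (cases "even d")
  case True
  then obtain h where h: "d = 2 * h" by blast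
  \<comment> \<open>The \<open>h\<close> smallest and the \<open>h\<close> largest nonzero residues;
    they are disjoint because \<open>2 * h < M\<close>.\<close>
  let ?S = "{1..h} \<union> {M - h..<M}"
  have "card ?S = h + h" using assms h by (subst card_Un_disjoint) auto
  then show ?thesis using assms h by (intro exI[of _ ?S]) auto
next
  case False
  then have "even (M - 1 - d)" using assms by auto
  then obtain h where h: "M - 1 - d = 2 * h" by blast
  \<comment> \<open>Here \<open>M\<close> is even. Dropping \<open>h\<close> residues at either end
    leaves \<open>d\<close> residues symmetric about \<open>M div 2\<close>, the one that is its own
    negative.\<close>
  let ?S = "{Suc h..<M - h}"
  show ?thesis using assms h by (intro exI[of _ ?S]) auto
qed

lemma good_regular:
  assumes "m - 4 < M" "even ((m - 4) * M)"
  shows "\<exists>G. good m (m - 4) M G"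
proof -
  obtain S where "S \<subseteq> {1..<M}" "card S = m - 4" "\<forall>s\<in>S. M - s \<in> S"
    using symmetric_residues[OF assms] by blast
  then have "good m (m - 4) M (circulant M S)"
    using simple_circulant[of S M] circulant_degree[of S M] by (auto simp: good_def)
  then show ?thesis by blast
qed

text \<open>A circulant works unless \<open>m\<close> and \<open>N\<close> are both odd. In that
  case a component \<open>K\<^sub>m\<^sub>-\<^sub>2\<close> takes an odd number of vertices and
  leaves an even one. By parity \<open>N \<ge> 2 * m - 5\<close>, so the rest is large enough for
  degree \<open>m - 4\<close>.\<close>

lemma good_exists:
  assumes m: "5 \<le> m" and N: "2 * m - 6 \<le> N"
  shows "\<exists>G. good m (m - 4) N G"
proof (cases "even ((m - 4) * N)")
  case True
  then show ?thesis using good_regular[of m N] m N by auto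
next
  case False
  then have odd: "odd (m - 4)" "odd N" by auto
  then have "odd m" using m by auto
  then have "N \<noteq> 2 * m - 6" "even (N - (m - 2))" using odd m N by auto
  then have "m - 4 < N - (m - 2)" "even ((m - 4) * (N - (m - 2)))" using m N by auto
  then obtain G where G: "good m (m - 4) (N - (m - 2)) G" using good_regular by blast
  have "good m (m - 4) (m - 2) (\<noteq>)" by (rule good_clique) (use m in auto)
  moreover have "m - 2 + (N - (m - 2)) = N" using m N by arith
  ultimately show ?thesis using good_disjoint_union[OF _ G] by metis
qed

section \<open>Sharpness and its arithmetic\<close>

lemma ramsey_sharp:
  assumes "5 \<le> m" "m < n" "\<not> (m - 1) dvd (n - 3)" and N: "m + n - 5 = s * (m - 1) + t * (m - 2)"
  shows "ramsey_number m (Tmi_edges i m) n (Tprime_edges n) = m + n - 4"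
    and "ramsey_number m (Tmi_edges i m) n (Tstar_edges n) = m + n - 4"
proof -
  obtain G where G: "good m (m - 3) (m + n - 5) G" using good_cliques[OF assms(1)] N by metis
  then have s: "simple_graph_on (m + n - 5) G" by (simp add: good_def)
  note free = good_Tmi_free[OF G assms(1), of i]
  \<comment> \<open>With \<open>d = m - 3\<close> the order \<open>m + n - 5\<close> meets the bound
    \<open>d + n - 2\<close> exactly.\<close>
  have "\<not> contains n (Tprime_edges n) (m + n - 5) (complement G)"
    by (rule good_complement_Tprime_free[OF G]) (use assms in auto)
  from ramsey_number_gt[OF ramsey_at_upper(1)[OF assms(1-3)] s free this]
  show "ramsey_number m (Tmi_edges i m) n (Tprime_edges n) = m + n - 4"
    using ramsey_number_le[OF ramsey_at_upper(1)[OF assms(1-3), of i]] by simp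
  have "\<not> contains n (Tstar_edges n) (m + n - 5) (complement G)"
    by (rule good_complement_Tstar_free[OF G]) (use assms in auto)
  from ramsey_number_gt[OF ramsey_at_upper(2)[OF assms(1-3)] s free this]
  show "ramsey_number m (Tmi_edges i m) n (Tstar_edges n) = m + n - 4"
    using ramsey_number_le[OF ramsey_at_upper(2)[OF assms(1-3), of i]] by simp
qed

text \<open>Start from \<open>K\<close> blocks of one size and change some of them by one:
  \<open>from_above\<close> shrinks \<open>t\<close> blocks of size \<open>m - 1\<close>,
  \<open>from_below\<close> enlarges \<open>s\<close> blocks of size \<open>m - 2\<close>. At most
  \<open>K\<close> blocks can be changed, and each condition secures this bound.\<close>

lemma two_clique_sizes:
  fixes m n k q a b :: nat
  assumes m: "5 \<le> m" "m < n" and b3: "b \<noteq> 3"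
    and n1: "n = k * (m - 1) + b" "b \<le> m - 2" and n2: "n = q * (m - 2) + a" "a \<le> m - 3"
    and cond: "b \<in> {1, 2, 4}
           \<or> (b = 0 \<and> 3 \<le> k)
           \<or> int n \<ge> (int m - 3)^2 + 2
           \<or> int n \<ge> (int m)^2 - 1 - int b * (int m - 2)
           \<or> (3 \<le> a \<and> int n \<ge> (int a - 4) * (int m - 1) + 4)"
  shows "\<exists>s t. m + n - 5 = s * (m - 1) + t * (m - 2)"
proof -
  obtain p where p: "m = p + 5" using le_Suc_ex[OF m(1)] by (auto simp: add.commute)
  have from_above: ?thesis if le: "t \<le> K" and eq: "m + n + t = K * (m - 1) + 5" for t K
  proof -
    obtain s where s: "K = s + t" using le_Suc_ex[OF le] by (auto simp: add.commute)
    have "m + n - 5 = s * (m - 1) + t * (m - 2)" using eq by (simp add: s p algebra_simps)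
    then show ?thesis by blast
  qed
  have from_below: ?thesis if le: "s \<le> K" and eq: "m + n = K * (m - 2) + s + 5" for s K
  proof -
    obtain t where t: "K = s + t" using le_Suc_ex[OF le] by auto
    have "m + n - 5 = s * (m - 1) + t * (m - 2)" using eq by (simp add: t p algebra_simps)
    then show ?thesis by blast
  qed
  \<comment> \<open>Here \<open>m + n - 5 = (q + 1) * (m - 2) + (a - 3)\<close>.\<close>
  have a_large: ?thesis if "3 \<le> a" "a \<le> q + 4"
    using that n2(1) by (intro from_below[of "a - 3" "q + 1"]) (auto simp: p algebra_simps)
  consider "b = 4" | "b = 2" | "b = 1" | "b = 0" "3 \<le> k" | "int n \<ge> (int m - 3)^2 + 2"
    | "int n \<ge> (int m)^2 - 1 - int b * (int m - 2)"
    | "3 \<le> a" "int n \<ge> (int a - 4) * (int m - 1) + 4"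
    using cond by auto
  then show ?thesis
  proof cases
    case 1
    \<comment> \<open>In terms of \<open>k\<close> the total is
      \<open>(k + 1) * (m - 1) - (4 - b)\<close>. So for \<open>b \<le> 4\<close>,
      \<open>4 - b\<close> of the \<open>k + 1\<close> blocks shrink, which requires
      \<open>3 - b \<le> k\<close>; this settles the first four cases.\<close>
    then show ?thesis using n1(1) by (intro from_above[of 0 "k + 1"]) (auto simp: p algebra_simps)
  next
    case 2
    then have "k \<noteq> 0" using n1 m by (intro notI) simp
    with 2 show ?thesis using n1(1) by (intro from_above[of 2 "k + 1"]) (auto simp: p algebra_simps)
  next
    case 3
    then have "k \<noteq> 0" "k \<noteq> 1" using n1 m by (intro notI, simp)+
    with 3 show ?thesis using n1(1) by (intro from_above[of 3 "k + 1"]) (auto simp: p algebra_simps)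
  next
    case 4
    then show ?thesis using n1(1) by (intro from_above[of 4 "k + 1"]) (auto simp: p algebra_simps)
  next
    case 5
    have q: "q * (p + 3) + a \<ge> (p + 2) * (p + 2) + 2"
    proof -
      have "int (q * (p + 3) + a) \<ge> int ((p + 2) * (p + 2) + 2)"
        using 5 n2(1) by (simp add: p power2_eq_square algebra_simps)
      then show ?thesis by linarith
    qed
    show ?thesis
    proof (cases "3 \<le> a")
      case True
      have "p \<le> q + 1"
      proof (rule ccontr)
        assume "\<not> ?thesis"
        then have "q * (p + 3) \<le> p * (p + 3)" by (intro mult_le_mono1) simp
        then show False using q n2(2) by (simp add: p algebra_simps)
      qed
      then show ?thesis using True n2(2) p by (intro a_large) auto
    next
      case False
      have "p + 2 \<le> q"
      proof (rule ccontr)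
        assume "\<not> ?thesis"
        then have "q * (p + 3) \<le> (p + 1) * (p + 3)" by (intro mult_le_mono1) simp
        then show False using q False by (simp add: algebra_simps)
      qed
      \<comment> \<open>For \<open>a < 3\<close> the difference \<open>a - 3\<close> is negative.
        One block is given up instead, and the surplus \<open>a + m - 5\<close> is spread over the
        other \<open>q\<close> blocks.\<close>
      then show ?thesis using False n2(1)
        by (intro from_below[of "a + p" q]) (auto simp: p algebra_simps)
    qed
  next
    case 6
    \<comment> \<open>Since \<open>m^2 - 1 = (m - 1) * (m + 1)\<close>, the condition divided by
      \<open>m - 1\<close> is exactly this inequality. It allows \<open>k + 2\<close> blocks, one
      more than before, of which \<open>m + 3 - b\<close> shrink.\<close>
    have "m + 1 \<le> k + b"
    proof (rule ccontr)
      assume "\<not> ?thesis"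
      then have "int k * (int m - 1) \<le> (int m - int b) * (int m - 1)"
        using m by (intro mult_right_mono) auto
      moreover have "int n = int k * (int m - 1) + int b"
        using n1(1) m by (simp add: of_nat_diff)
      ultimately show False using 6 m by (simp add: power2_eq_square algebra_simps)
    qed
    then show ?thesis using n1
      by (intro from_above[of "m + 3 - b" "k + 2"]) (auto simp: p algebra_simps)
  next
    case 7
    \<comment> \<open>Substituting \<open>n = q * (m - 2) + a\<close> reduces the condition to
      \<open>(a - 4) * (m - 2) \<le> q * (m - 2)\<close>.\<close>
    have "a \<le> q + 4"
    proof (rule ccontr)
      assume "\<not> ?thesis"
      then have "int q * (int m - 2) \<le> (int a - 5) * (int m - 2)"
        using m by (intro mult_right_mono) auto
      moreover have "int n = int q * (int m - 2) + int a"
        using n2(1) m by (simp add: of_nat_diff)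
      ultimately show False using 7 m by (simp add: algebra_simps)
    qed
    then show ?thesis using 7 by (intro a_large)
  qed
qed

theorem theorem5p3:
  fixes i m n k q a b :: nat
  assumes "i \<in> {1, 2}"
    and "5 \<le> m" and "m < n"
    and "\<not> (m - 1) dvd (n - 3)"
    and "n = k * (m - 1) + b" and "b \<le> m - 2"
    and "n = q * (m - 2) + a" and "a \<le> m - 3"
  shows "m + n - 5 \<le> ramsey_number m (Tmi_edges i m) n (Tprime_edges n)
       \<and> ramsey_number m (Tmi_edges i m) n (Tprime_edges n) \<le> m + n - 4
       \<and> m + n - 6 \<le> ramsey_number m (Tmi_edges i m) n (Tstar_edges n)
       \<and> ramsey_number m (Tmi_edges i m) n (Tstar_edges n) \<le> m + n - 4
       \<and> ((b \<in> {1, 2, 4}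
           \<or> (b = 0 \<and> 3 \<le> k)
           \<or> int n \<ge> (int m - 3)^2 + 2
           \<or> int n \<ge> (int m)^2 - 1 - int b * (int m - 2)
           \<or> (3 \<le> a \<and> int n \<ge> (int a - 4) * (int m - 1) + 4))
          \<longrightarrow> ramsey_number m (Tmi_edges i m) n (Tstar_edges n) = m + n - 4
            \<and> ramsey_number m (Tmi_edges i m) n (Tprime_edges n) = m + n - 4)"
proof -
  note mn = assms(2-4)
  note up = ramsey_at_upper[OF mn, of i]
  have "2 * m - 6 \<le> m + n - 6" "2 * m - 6 \<le> m + n - 7" using mn(1,2) by linarith+
  from good_exists[OF mn(1) this(1)] good_exists[OF mn(1) this(2)]
  obtain G G' where G: "good m (m - 4) (m + n - 6) G" and G': "good m (m - 4) (m + n - 7) G'"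
    by blast
  have "\<not> contains n (Tprime_edges n) (m + n - 6) (complement G)"
    by (rule good_complement_Tprime_free[OF G]) (use mn in auto)
  from ramsey_number_gt[OF up(1) _ good_Tmi_free[OF G mn(1)] this] G
  have low1: "m + n - 5 \<le> ramsey_number m (Tmi_edges i m) n (Tprime_edges n)"
    using mn by (auto simp: good_def)
  have "\<not> contains n (Tstar_edges n) (m + n - 7) (complement G')"
    by (rule good_complement_Tstar_free[OF G']) (use mn in auto)
  from ramsey_number_gt[OF up(2) _ good_Tmi_free[OF G' mn(1)] this] G'
  have low2: "m + n - 6 \<le> ramsey_number m (Tmi_edges i m) n (Tstar_edges n)"
    using mn by (auto simp: good_def)
  have "b \<noteq> 3"
  proof
    assume "b = 3"
    then have "n - 3 = k * (m - 1)" using assms(5) by simp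
    then show False using mn(3) by simp
  qed
  note sizes = two_clique_sizes[OF mn(1,2) this assms(5-8)]
  show ?thesis
    using low1 low2 ramsey_number_le[OF up(1)] ramsey_number_le[OF up(2)]
      sizes ramsey_sharp[OF mn, of _ _ i] by blast
qed

end
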